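(* Let $N\ge2$ and $T\ge1$ be integers, and let $l_{i,t}$ (losses), $\upsilon_{i,t}$ (upper bounds) and $\mathcal{M}_t$, $1\le i\le N$, $1\le t\le T$, be real numbers, fixed in advance (oblivious adversary), such that $l_{i,t}\le\upsilon_{i,t}$ for all $i,t$ and $\max_i\{\upsilon_{i,t}-l_{i,t}\}\le\mathcal{M}_t$ for all $t$. Suppose that on each round the learner is given the upper bounds $\upsilon_{1,t},\ldots,\upsilon_{N,t}$ along with the loss of its chosen expert, and knows $\mathcal{M}_t$. Put $\alpha_{i,t}=\upsilon_{i,t}-\mathcal{M}_t$ and $\boldsymbol{\alpha}_t=(\alpha_{1,t},\ldots,\alpha_{N,t})$. If $\mathcal{Q}_\alpha>0$ is an upper bound on $$\frac{1}{2} q(\boldsymbol{\alpha}_{1:T})+2\sum_{t=1}^T \sum_{i=1}^N (l_{i,t}-\alpha_{i,t})^2+4\sum_{t=1}^T \max_i\{l_{i,t}-\alpha_{i,t}\}\cdot d(\boldsymbol{\alpha}_t),$$ then for $\eta = \sqrt{4\log N/\mathcal{Q}_\alpha}$, the algorithm Exp3.UB with parameter $\eta$ satisfies $$\mathbb{E}\, R_{Exp3.UB,T} \leq \sqrt{\mathcal{Q}_\alpha \log N}.$$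
   Context: Notation: for $\mathbf{x}\in\mathbb{R}^N$, $d(\mathbf{x})=\max_i\{x_i\}-\min_i\{x_i\}$; for vectors $\mathbf{x}_1,\ldots,\mathbf{x}_T\in\mathbb{R}^N$, $q(\mathbf{x}_{1:T})=\sum_{t=1}^T d(\mathbf{x}_t)^2$; $\log$ is the natural logarithm. Model: there are $N$ experts and $T$ rounds. On each round $t$ the learner draws an expert $I_t$ from a distribution $\mathbf{p}_t$ on $\{1,\ldots,N\}$ (conditionally on the past) and incurs loss $l_{I_t,t}$. Exp3.UB with parameter $\eta>0$: with $\alpha_{i,t}=\upsilon_{i,t}-\mathcal{M}_t$, $\mathbf{p}_1$ is uniform and $\widetilde{L}_{i,0}=0$ for all $i$. On each round $t=1,\ldots,T$: draw $I_t\sim\mathbf{p}_t$; set $\widetilde{l}_{i,t} = \frac{l_{i,t}-\alpha_{i,t}}{p_{i,t}}\mathbb{I}\{I_t=i\}+\alpha_{i,t}$ and $\widetilde{L}_{i,t}=\widetilde{L}_{i,t-1}+\widetilde{l}_{i,t}$ for every $i$; set $p_{i,t+1}=\exp(-\eta \widetilde{L}_{i,t})/\sum_{k=1}^N\exp(-\eta\widetilde{L}_{k,t})$. The regret is $R_{Exp3.UB,T}=\sum_{t=1}^T l_{I_t,t}-\min_j\sum_{t=1}^T l_{j,t}$. *)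

theory Defs
  imports "HOL-Probability.Probability"
begin

text \<open>
  Experts are the numbers \<open>1..N\<close> and rounds the numbers \<open>1..T\<close>. A family \<open>x\<close> indexed by experts
  and rounds is a function with \<open>x i t\<close> standing for $x_{i,t}$; values outside the index ranges
  are irrelevant.
\<close>

definition spread :: "nat \<Rightarrow> (nat \<Rightarrow> real) \<Rightarrow> real" where
  "spread N x = Max (x ` {1..N}) - Min (x ` {1..N})"

definition quad_spread :: "nat \<Rightarrow> nat \<Rightarrow> (nat \<Rightarrow> nat \<Rightarrow> real) \<Rightarrow> real" where
  "quad_spread N T x = (\<Sum>t=1..T. (spread N (\<lambda>i. x i t))\<^sup>2)"

definition offset :: "(nat \<Rightarrow> nat \<Rightarrow> real) \<Rightarrow> (nat \<Rightarrow> real) \<Rightarrow> nat \<Rightarrow> nat \<Rightarrow> real" where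
  "offset ub M i t = ub i t - M t"

definition exp_weights :: "nat \<Rightarrow> real \<Rightarrow> (nat \<Rightarrow> real) \<Rightarrow> nat \<Rightarrow> real" where
  "exp_weights N \<eta> L i = exp (- \<eta> * L i) / (\<Sum>k=1..N. exp (- \<eta> * L k))"

text \<open>
  The quantities maintained by the algorithm are functions of the sequence of drawn experts, where
  \<open>I t\<close> is the expert drawn on round \<open>t\<close>.
\<close>

definition loss_estimate ::
  "(nat \<Rightarrow> nat \<Rightarrow> real) \<Rightarrow> (nat \<Rightarrow> nat \<Rightarrow> real) \<Rightarrow> (nat \<Rightarrow> real) \<Rightarrow> (nat \<Rightarrow> nat) \<Rightarrow> nat \<Rightarrow> nat \<Rightarrow> real"
  where
  "loss_estimate l \<alpha> p I t i = (l i t - \<alpha> i t) / p i * of_bool (I t = i) + \<alpha> i t"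

primrec cum_estimate ::
  "nat \<Rightarrow> real \<Rightarrow> (nat \<Rightarrow> nat \<Rightarrow> real) \<Rightarrow> (nat \<Rightarrow> nat \<Rightarrow> real) \<Rightarrow> (nat \<Rightarrow> nat) \<Rightarrow> nat \<Rightarrow> nat \<Rightarrow> real"
  where
  "cum_estimate N \<eta> l \<alpha> I 0 = (\<lambda>i. 0)"
| "cum_estimate N \<eta> l \<alpha> I (Suc t) =
     (\<lambda>i. cum_estimate N \<eta> l \<alpha> I t i +
          loss_estimate l \<alpha> (exp_weights N \<eta> (cum_estimate N \<eta> l \<alpha> I t)) I (Suc t) i)"

text \<open>
  The distribution used on round \<open>t \<ge> 1\<close>; that it is uniform for \<open>t = 1\<close> is \<open>exp3ub_prob_1\<close> below.
\<close>

definition exp3ub_prob ::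
  "nat \<Rightarrow> real \<Rightarrow> (nat \<Rightarrow> nat \<Rightarrow> real) \<Rightarrow> (nat \<Rightarrow> nat \<Rightarrow> real) \<Rightarrow> (nat \<Rightarrow> nat) \<Rightarrow> nat \<Rightarrow> nat \<Rightarrow> real"
  where
  "exp3ub_prob N \<eta> l \<alpha> I t = exp_weights N \<eta> (cum_estimate N \<eta> l \<alpha> I (t - 1))"

text \<open>
  \<open>embed_pmf\<close> is only meaningful for nonnegative weights of total mass one; \<open>pmf_draw_expert\<close> below
  shows that this holds for the distributions of the algorithm.
\<close>

definition draw_expert :: "nat \<Rightarrow> (nat \<Rightarrow> real) \<Rightarrow> nat pmf" where
  "draw_expert N p = embed_pmf (\<lambda>i. if i \<in> {1..N} then p i else 0)"

text \<open>
  The joint law of the draws of the first \<open>t\<close> rounds. The initial sequence is a dummy: its values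
  are never read, because the distribution of round \<open>t\<close> depends on the draws of earlier rounds only
  (\<open>exp3ub_prob_cong\<close>).
\<close>

primrec exp3ub_draws ::
  "nat \<Rightarrow> real \<Rightarrow> (nat \<Rightarrow> nat \<Rightarrow> real) \<Rightarrow> (nat \<Rightarrow> nat \<Rightarrow> real) \<Rightarrow> nat \<Rightarrow> (nat \<Rightarrow> nat) pmf"
  where
  "exp3ub_draws N \<eta> l \<alpha> 0 = return_pmf (\<lambda>_. undefined)"
| "exp3ub_draws N \<eta> l \<alpha> (Suc t) =
     bind_pmf (exp3ub_draws N \<eta> l \<alpha> t) (\<lambda>I.
       bind_pmf (draw_expert N (exp3ub_prob N \<eta> l \<alpha> I (Suc t))) (\<lambda>i.
         return_pmf (I(Suc t := i))))"

definition regret :: "nat \<Rightarrow> nat \<Rightarrow> (nat \<Rightarrow> nat \<Rightarrow> real) \<Rightarrow> (nat \<Rightarrow> nat) \<Rightarrow> real" where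
  "regret N T l I = (\<Sum>t=1..T. l (I t) t) - Min ((\<lambda>j. \<Sum>t=1..T. l j t) ` {1..N})"

lemma exp3ub_prob_1: "exp3ub_prob N \<eta> l \<alpha> I 1 i = 1 / real N"
  by (simp add: exp3ub_prob_def exp_weights_def)

lemma cum_estimate_cong:
  "(\<And>s. 1 \<le> s \<Longrightarrow> s \<le> t \<Longrightarrow> I s = J s) \<Longrightarrow>
   cum_estimate N \<eta> l \<alpha> I t = cum_estimate N \<eta> l \<alpha> J t"
  by (induction t) (simp_all add: loss_estimate_def)

lemma exp3ub_prob_cong:
  "(\<And>s. 1 \<le> s \<Longrightarrow> s < t \<Longrightarrow> I s = J s) \<Longrightarrow>
   exp3ub_prob N \<eta> l \<alpha> I t = exp3ub_prob N \<eta> l \<alpha> J t"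
  unfolding exp3ub_prob_def by (subst cum_estimate_cong[of "t - 1" I J]) auto

lemma pmf_draw_expert:
  assumes "N \<ge> 1"
  shows "pmf (draw_expert N (exp3ub_prob N \<eta> l \<alpha> I t)) i =
         (if i \<in> {1..N} then exp3ub_prob N \<eta> l \<alpha> I t i else 0)"
proof -
  let ?L = "cum_estimate N \<eta> l \<alpha> I (t - 1)"
  let ?f = "\<lambda>i. if i \<in> {1..N} then exp3ub_prob N \<eta> l \<alpha> I t i else 0"
  have pos: "(\<Sum>k=1..N. exp (- \<eta> * ?L k)) > 0"
    using assms by (intro sum_pos) auto
  have nonneg: "?f j \<ge> 0" for j
    using pos by (simp add: exp3ub_prob_def exp_weights_def)
  have "(\<Sum>j=1..N. exp3ub_prob N \<eta> l \<alpha> I t j) = 1"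
    using pos by (simp add: exp3ub_prob_def exp_weights_def flip: sum_divide_distrib)
  moreover have "(\<Sum>j=1..N. ?f j) = (\<Sum>j=1..N. exp3ub_prob N \<eta> l \<alpha> I t j)"
    by (rule sum.cong) auto
  ultimately have one: "(\<Sum>j=1..N. ?f j) = 1"
    by simp
  have "(\<integral>\<^sup>+j. ennreal (?f j) \<partial>count_space UNIV) = (\<Sum>j=1..N. ennreal (?f j))"
    by (rule nn_integral_count_space'[where A = "{1..N}"]) auto
  also have "\<dots> = 1"
    by (simp only: sum_ennreal[OF nonneg] one ennreal_1)
  finally have "(\<integral>\<^sup>+j. ennreal (?f j) \<partial>count_space UNIV) = 1" .
  thus ?thesis
    unfolding draw_expert_def using nonneg by (intro pmf_embed_pmf)
qed

end

theory Submission
  imports Defs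
begin

text \<open>
  The potential \<open>\<eta>\<close> times the loss suffered so far, plus the logarithm of
  \<open>\<Sum>i. exp (- \<eta> L i)\<close> for the cumulative estimates \<open>L\<close>, grows in expectation by at most \<open>\<eta>\<^sup>2/4\<close>
  times the contribution of the round to the quantity bounded by \<open>Q\<close>; as the estimates are
  unbiased, the regret bound follows. In a round the weights are tilted first by the offsets \<open>\<alpha>\<close>, which
  Hoeffding's lemma controls, and then by the nonnegative importance-weighted part of the estimate,
  which only affects the drawn expert. The first tilt changes the probability of that expert
  at worst by the factor \<open>1 - \<eta> d(\<alpha>)\<close>; this produces the mixed term.
\<close>

section \<open>Elementary inequalities for the exponential and the logarithm\<close>

lemma exp_minus_le_quadratic:
  fixes u :: real
  assumes "u \<ge> 0"
  shows "exp (- u) \<le> 1 - u + u\<^sup>2 / 2"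
proof -
  \<comment> \<open>The two quadratics multiply to at least 1, so the Taylor bound
    \<open>1 + u + u\<^sup>2 / 2 \<le> exp u\<close> can be inverted into an upper bound on
    \<open>exp (- u)\<close>.\<close>
  have "(1 - u + u\<^sup>2 / 2) * (1 + u + u\<^sup>2 / 2) = 1 + (u\<^sup>2)\<^sup>2 / 4"
    by (simp add: field_simps power2_eq_square)
  hence ge1: "1 \<le> (1 - u + u\<^sup>2 / 2) * (1 + u + u\<^sup>2 / 2)"
    by simp
  have "0 < 1 + u + u\<^sup>2 / 2"
    using assms by (simp add: add_pos_nonneg)
  moreover from this ge1 have "0 \<le> 1 - u + u\<^sup>2 / 2"
    by (smt (verit) mult_nonpos_nonneg)
  ultimately have "1 \<le> (1 - u + u\<^sup>2 / 2) * exp u"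
    using ge1 exp_lower_Taylor_quadratic[OF assms] by (meson mult_left_mono order_trans)
  thus ?thesis
    by (simp add: exp_minus field_simps)
qed

text \<open>In the application \<open>p\<close> and \<open>r\<close> are the probabilities of the
  drawn expert before and after the tilt by the offsets, and \<open>e\<close> bounds the relative
  decrease. Since \<open>ln z \<le> z - 1\<close>, a lower bound on
  \<open>r * (1 - exp (- u))\<close> suffices.\<close>

lemma ln_tilt_le:
  fixes p r u e :: real
  assumes "0 \<le> p" "0 \<le> r" "r \<le> 1" "0 \<le> u" "0 \<le> e" and r: "(1 - e) * p \<le> r"
  shows "ln (1 - r + r * exp (- u)) \<le> - p * u + p * u\<^sup>2 / 2 + e * (p * u)"
proof -
  have pos: "0 < 1 - r + r * exp (- u)"
    using assms by (cases "r = 1") (auto intro!: add_pos_nonneg)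
  have "ln (1 - r + r * exp (- u)) \<le> - (r * (1 - exp (- u)))"
    using ln_le_minus_one[OF pos] by (simp add: algebra_simps)
  also have "\<dots> \<le> - p * u + p * u\<^sup>2 / 2 + e * (p * u)"
  \<comment> \<open>Up to \<open>u = 2\<close> the lower bound \<open>u - u\<^sup>2 / 2\<close> on
    \<open>1 - exp (- u)\<close> is nonnegative, so that \<open>r\<close> may be replaced by
    \<open>(1 - e) * p\<close>. Beyond 2 the right-hand side is nonnegative because
    \<open>p * u\<^sup>2 / 2\<close> dominates \<open>p * u\<close>, while the left-hand side is at
    most 0.\<close>
  proof (cases "u \<le> 2")
    case True
    have w: "0 \<le> u - u\<^sup>2 / 2"
      using True assms mult_nonneg_nonneg[of u "2 - u"]
      by (simp add: power2_eq_square algebra_simps)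
    have "(1 - e) * p * (u - u\<^sup>2 / 2) \<le> r * (u - u\<^sup>2 / 2)"
      using r w by (rule mult_right_mono)
    also have "\<dots> \<le> r * (1 - exp (- u))"
      using exp_minus_le_quadratic[OF \<open>0 \<le> u\<close>] assms by (intro mult_left_mono) auto
    finally have "(1 - e) * p * (u - u\<^sup>2 / 2) \<le> r * (1 - exp (- u))" .
    moreover have "0 \<le> e * p * (u\<^sup>2 / 2)"
      using assms by simp
    ultimately show ?thesis
      by (simp add: algebra_simps diff_divide_distrib)
  next
    case False
    have "0 \<le> r * (1 - exp (- u))"
      using assms by simp
    moreover have "0 \<le> p * u * (u - 2)" "0 \<le> e * (p * u)"
      using False assms by auto
    ultimately show ?thesis
      by (simp add: algebra_simps power2_eq_square)
  qed
  finally show ?thesis .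
qed

section \<open>One round: tilting the weights by the offsets and by the importance-weighted
  loss\<close>

lemma Hoeffding_lemma_pmf:
  fixes P :: "'a pmf" and x :: "'a \<Rightarrow> real"
  assumes fin: "finite (set_pmf P)"
    and bounds: "\<And>i. i \<in> set_pmf P \<Longrightarrow> a \<le> x i \<and> x i \<le> b"
    and "\<eta> > 0"
  shows "measure_pmf.expectation P (\<lambda>i. exp (- \<eta> * x i))
         \<le> exp (- \<eta> * measure_pmf.expectation P x + \<eta>\<^sup>2 * (b - a)\<^sup>2 / 8)"
proof -
  let ?E = "measure_pmf.expectation P"
  let ?m = "?E x"
  \<comment> \<open>Passing to \<open>- x\<close> turns the negative exponent into the positive one
    of the library lemma and keeps the length \<open>b - a\<close> of the range.\<close>
  have "interval_bounded_random_variable (measure_pmf P) (\<lambda>i. - x i) (- b) (- a)"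
    by unfold_locales (auto simp: AE_measure_pmf_iff bounds)
  note Hoeffding = interval_bounded_random_variable.Hoeffdings_lemma_nn_integral[OF this \<open>\<eta> > 0\<close>]
  note integrable = integrable_measure_pmf_finite[OF fin]
  have "ennreal (?E (\<lambda>i. exp (\<eta> * (- x i - ?E (\<lambda>i. - x i)))))
      = (\<integral>\<^sup>+i. exp (\<eta> * (- x i - ?E (\<lambda>i. - x i))) \<partial>measure_pmf P)"
    by (intro nn_integral_eq_integral[symmetric] integrable) auto
  also have "\<dots> \<le> ennreal (exp (\<eta>\<^sup>2 * (- a - - b)\<^sup>2 / 8))"
    by (rule Hoeffding)
  finally have "?E (\<lambda>i. exp (\<eta> * ?m) * exp (- \<eta> * x i))
      \<le> exp (\<eta>\<^sup>2 * (b - a)\<^sup>2 / 8)"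
    by (simp add: algebra_simps flip: exp_add)
  hence "exp (\<eta> * ?m) * ?E (\<lambda>i. exp (- \<eta> * x i))
      \<le> exp (\<eta>\<^sup>2 * (b - a)\<^sup>2 / 8)"
    by simp
  from mult_left_mono[OF this, of "exp (- \<eta> * ?m)"] show ?thesis
    by (simp flip: exp_add mult.assoc)
qed

text \<open>With \<open>Z\<close> the total weight after the tilt by the offsets and
  \<open>r\<close> the share of \<open>k\<close> in it, the sum factors as
  \<open>Z * (1 - r + r * exp (- u))\<close>. Hoeffding's lemma bounds \<open>ln Z\<close>, and
  \<open>ln_tilt_le\<close> with \<open>e = \<eta> * d\<close> bounds the logarithm of the other
  factor.\<close>

lemma ln_weighted_exp_le:
  fixes P :: "'a pmf" and \<alpha> :: "'a \<Rightarrow> real"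
  assumes A: "finite A" "set_pmf P = A" and k: "k \<in> A" and "\<eta> > 0" "0 \<le> c" "0 \<le> d"
    and bounds: "\<And>i. i \<in> A \<Longrightarrow> a \<le> \<alpha> i \<and> \<alpha> i \<le> a + d"
  shows "ln (\<Sum>i\<in>A. pmf P i * exp (- \<eta> * (c / pmf P k * of_bool (k = i) + \<alpha> i)))
         \<le> - \<eta> * (\<Sum>i\<in>A. pmf P i * \<alpha> i) + \<eta>\<^sup>2 * d\<^sup>2 / 8
           - \<eta> * c + \<eta>\<^sup>2 * c\<^sup>2 / (2 * pmf P k) + \<eta>\<^sup>2 * d * c"
proof -
  define Z where "Z = (\<Sum>i\<in>A. pmf P i * exp (- \<eta> * \<alpha> i))"
  define p where "p = pmf P k"
  define r where "r = p * exp (- \<eta> * \<alpha> k) / Z"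
  define u where "u = \<eta> * c / p"
  have E: "measure_pmf.expectation P f = (\<Sum>i\<in>A. pmf P i * f i)" for f :: "'a \<Rightarrow> real"
    using A by (subst integral_measure_pmf_real[of A]) (auto simp: mult.commute)
  have "p > 0"
    using A k by (auto simp: p_def pmf_positive_iff)
  have Z_split: "Z = p * exp (- \<eta> * \<alpha> k) + (\<Sum>i\<in>A - {k}. pmf P i * exp (- \<eta> * \<alpha> i))"
    unfolding Z_def p_def using A k by (intro sum.remove) auto
  moreover have "0 < p * exp (- \<eta> * \<alpha> k)"
    using \<open>p > 0\<close> by simp
  moreover have "0 \<le> (\<Sum>i\<in>A - {k}. pmf P i * exp (- \<eta> * \<alpha> i))"
    by (intro sum_nonneg) auto
  ultimately have "Z > 0" "r \<le> 1" "r > 0"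
    by (auto simp: r_def)
  have "(\<Sum>i\<in>A. pmf P i) = 1"
    using A by (intro sum_pmf_eq_1) auto
  have "Z \<le> (\<Sum>i\<in>A. pmf P i * exp (- \<eta> * a))"
    unfolding Z_def using bounds \<open>\<eta> > 0\<close> by (intro sum_mono mult_left_mono) auto
  hence "Z \<le> exp (- \<eta> * a)"
    using \<open>(\<Sum>i\<in>A. pmf P i) = 1\<close> by (simp flip: sum_distrib_right)
  \<comment> \<open>The share \<open>r\<close> is smallest when \<open>k\<close> has the largest
    offset \<open>a + d\<close> and \<open>Z\<close> attains its bound
    \<open>exp (- \<eta> * a)\<close>; even then it is \<open>p * exp (- \<eta> * d)\<close>, which
    is at least \<open>(1 - \<eta> * d) * p\<close>.\<close>
  have "(1 - \<eta> * d) * Z \<le> exp (- \<eta> * d) * Z"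
    using \<open>Z > 0\<close>
      exp_ge_add_one_self[of "- (\<eta> * d)"] by (intro mult_right_mono) auto
  also have "\<dots> \<le> exp (- \<eta> * d) * exp (- \<eta> * a)"
    using \<open>Z \<le> exp (- \<eta> * a)\<close> by simp
  also have "\<dots> \<le> exp (- \<eta> * \<alpha> k)"
    using mult_left_mono[of "\<alpha> k" "a + d" \<eta>] bounds[OF k] \<open>\<eta> > 0\<close>
    by (simp add: algebra_simps flip: exp_add)
  finally have "(1 - \<eta> * d) * Z \<le> exp (- \<eta> * \<alpha> k)" .
  from mult_left_mono[OF this, of p] have r_ge: "(1 - \<eta> * d) * p \<le> r"
    using \<open>Z > 0\<close> \<open>p > 0\<close> by (simp add: r_def pos_le_divide_eq mult_ac)
  have "(\<Sum>i\<in>A. pmf P i * exp (- \<eta> * (c / pmf P k * of_bool (k = i) + \<alpha> i)))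
      = p * exp (- \<eta> * \<alpha> k) * exp (- u) + (\<Sum>i\<in>A - {k}. pmf P i * exp (- \<eta> * \<alpha> i))"
    using A k by (subst sum.remove[of A k])
      (auto simp: p_def u_def algebra_simps intro!: sum.cong simp flip: exp_add)
  also have "\<dots> = Z - p * exp (- \<eta> * \<alpha> k) + p * exp (- \<eta> * \<alpha> k) * exp (- u)"
    using Z_split by simp
  also have "\<dots> = Z * (1 - r + r * exp (- u))"
    using \<open>Z > 0\<close> by (simp add: r_def field_simps)
  finally have "ln (\<Sum>i\<in>A. pmf P i * exp (- \<eta> * (c / pmf P k * of_bool (k = i) + \<alpha> i)))
      = ln (Z * (1 - r + r * exp (- u)))"
    by simp
  also have "\<dots> = ln Z + ln (1 - r + r * exp (- u))"
  proof (rule ln_mult_pos)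
    show "0 < 1 - r + r * exp (- u)"
      using \<open>r \<le> 1\<close> \<open>r > 0\<close> by (intro add_nonneg_pos) auto
  qed (fact \<open>Z > 0\<close>)
  also have "ln (1 - r + r * exp (- u)) \<le> - p * u + p * u\<^sup>2 / 2 + (\<eta> * d) * (p * u)"
    using assms \<open>p > 0\<close> \<open>r > 0\<close> \<open>r \<le> 1\<close> r_ge by (intro ln_tilt_le) (auto simp: u_def)
  \<comment> \<open>The importance weight cancels in \<open>p * u = \<eta> * c\<close>, but one
    factor \<open>1 / p\<close> survives in \<open>p * u\<^sup>2\<close>.\<close>
  also have "\<dots> = - \<eta> * c + \<eta>\<^sup>2 * c\<^sup>2 / (2 * p) + \<eta>\<^sup>2 * d * c"
    using \<open>p > 0\<close> by (simp add: u_def field_simps power2_eq_square)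
  also have "ln Z \<le> - \<eta> * (\<Sum>i\<in>A. pmf P i * \<alpha> i) + \<eta>\<^sup>2 * d\<^sup>2 / 8"
  proof -
    have "Z \<le> exp (- \<eta> * (\<Sum>i\<in>A. pmf P i * \<alpha> i) + \<eta>\<^sup>2 * d\<^sup>2 / 8)"
      using Hoeffding_lemma_pmf[of P a \<alpha> "a + d" \<eta>] A bounds \<open>\<eta> > 0\<close> by (simp add: E Z_def)
    hence "ln Z \<le> ln (exp (- \<eta> * (\<Sum>i\<in>A. pmf P i * \<alpha> i) + \<eta>\<^sup>2 * d\<^sup>2 / 8))"
      using \<open>Z > 0\<close> by (subst ln_le_cancel_iff) auto
    thus ?thesis
      by simp
  qed
  finally show ?thesis
    by (simp add: p_def)
qed

section \<open>The law of the draws and the unbiasedness of the estimates\<close>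

lemma exp_weights_pos:
  assumes "N \<ge> 1"
  shows "exp_weights N \<eta> L i > 0"
proof -
  have "(\<Sum>k=1..N. exp (- \<eta> * L k)) > 0"
    using assms by (intro sum_pos) auto
  thus ?thesis
    by (simp add: exp_weights_def)
qed

lemma set_draw_expert:
  assumes "N \<ge> 1"
  shows "set_pmf (draw_expert N (exp3ub_prob N \<eta> l \<alpha> I t)) = {1..N}"
proof -
  have "exp3ub_prob N \<eta> l \<alpha> I t i \<noteq> 0" for i
    using exp_weights_pos[OF assms, of \<eta> _ i] by (simp add: exp3ub_prob_def less_imp_neq[symmetric])
  thus ?thesis
    by (auto simp: set_pmf_iff pmf_draw_expert[OF assms] split: if_splits)
qed

text \<open>Finite support makes every real function of the draws integrable.\<close>

lemma finite_set_exp3ub_draws: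
  assumes "N \<ge> 1"
  shows "finite (set_pmf (exp3ub_draws N \<eta> l \<alpha> t))"
  by (induction t) (auto simp: set_draw_expert[OF assms])

text \<open>The tower rule: a one-round estimate that holds for each fixed past \<open>I\<close>,
  averaged over the next draw, passes to expectations.\<close>

lemma expectation_exp3ub_draws_Suc:
  fixes f :: "(nat \<Rightarrow> nat) \<Rightarrow> real"
  assumes "N \<ge> 1"
  shows "measure_pmf.expectation (exp3ub_draws N \<eta> l \<alpha> (Suc t)) f =
         measure_pmf.expectation (exp3ub_draws N \<eta> l \<alpha> t)
           (\<lambda>I. \<Sum>k=1..N. exp3ub_prob N \<eta> l \<alpha> I (Suc t) k * f (I(Suc t := k)))"
proof -
  let ?D = "exp3ub_draws N \<eta> l \<alpha> t"
  let ?P = "\<lambda>I. draw_expert N (exp3ub_prob N \<eta> l \<alpha> I (Suc t))"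
  note fin = finite_set_exp3ub_draws[OF assms]
  have inner: "measure_pmf.expectation (bind_pmf (?P I) (\<lambda>k. return_pmf (I(Suc t := k)))) f
      = (\<Sum>k=1..N. exp3ub_prob N \<eta> l \<alpha> I (Suc t) k * f (I(Suc t := k)))" for I
    by (subst pmf_expectation_bind[of "{1..N}"])
      (auto simp: set_draw_expert[OF assms] pmf_draw_expert[OF assms])
  have "measure_pmf.expectation (exp3ub_draws N \<eta> l \<alpha> (Suc t)) f
      = (\<Sum>I\<in>set_pmf ?D. pmf ?D I * (\<Sum>k=1..N. exp3ub_prob N \<eta> l \<alpha> I (Suc t) k * f (I(Suc t := k))))"
    unfolding exp3ub_draws.simps
    by (subst pmf_expectation_bind[of "set_pmf ?D"])
      (auto simp: fin set_draw_expert[OF assms] inner)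
  also have "\<dots> = measure_pmf.expectation ?D
      (\<lambda>I. \<Sum>k=1..N. exp3ub_prob N \<eta> l \<alpha> I (Suc t) k * f (I(Suc t := k)))"
    by (subst integral_measure_pmf_real[of "set_pmf ?D"]) (auto simp: fin mult.commute)
  finally show ?thesis .
qed

lemma sum_exp3ub_prob:
  assumes "N \<ge> 1"
  shows "(\<Sum>k=1..N. exp3ub_prob N \<eta> l \<alpha> I t k) = 1"
proof -
  have "(\<Sum>k=1..N. exp3ub_prob N \<eta> l \<alpha> I t k)
      = (\<Sum>k=1..N. pmf (draw_expert N (exp3ub_prob N \<eta> l \<alpha> I t)) k)"
    by (intro sum.cong) (auto simp: pmf_draw_expert[OF assms])
  also have "\<dots> = 1"
    by (intro sum_pmf_eq_1) (auto simp: set_draw_expert[OF assms])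
  finally show ?thesis .
qed

text \<open>Earlier estimates do not see the new draw. In the new increment the loss and probability
  of \<open>i\<close> are written as those of \<open>k\<close>: the indicator vanishes unless the
  two agree, and the coefficient becomes the constant that \<open>ln_weighted_exp_le\<close>
  expects.\<close>

lemma cum_estimate_Suc_upd:
  "cum_estimate N \<eta> l \<alpha> (I(Suc t := k)) (Suc t) i =
     cum_estimate N \<eta> l \<alpha> I t i
     + ((l k (Suc t) - \<alpha> k (Suc t)) / exp3ub_prob N \<eta> l \<alpha> I (Suc t) k * of_bool (k = i)
        + \<alpha> i (Suc t))"
proof -
  have "cum_estimate N \<eta> l \<alpha> (I(Suc t := k)) t = cum_estimate N \<eta> l \<alpha> I t"
    by (rule cum_estimate_cong) auto
  thus ?thesis
    by (auto simp: loss_estimate_def exp3ub_prob_def)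
qed

text \<open>Expert \<open>j\<close> is drawn with exactly the probability by which its shifted loss
  is divided. The two cancel, and adding back the offset leaves the true loss.\<close>

lemma expectation_cum_estimate:
  assumes "j \<in> {1..N}"
  shows "measure_pmf.expectation (exp3ub_draws N \<eta> l \<alpha> t) (\<lambda>I. cum_estimate N \<eta> l \<alpha> I t j)
         = (\<Sum>s=1..t. l j s)"
proof (induction t)
  case 0
  show ?case by simp
next
  case (Suc t)
  have N: "N \<ge> 1"
    using assms by auto
  let ?p = "\<lambda>I. exp3ub_prob N \<eta> l \<alpha> I (Suc t)"
  let ?b = "l j (Suc t) - \<alpha> j (Suc t)"
  have step: "(\<Sum>k=1..N. ?p I k * cum_estimate N \<eta> l \<alpha> (I(Suc t := k)) (Suc t) j)
      = cum_estimate N \<eta> l \<alpha> I t j + l j (Suc t)" for I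
  proof -
    have "?p I j > 0"
      using exp_weights_pos[OF N] by (simp add: exp3ub_prob_def)
    have "(\<Sum>k=1..N. ?p I k * cum_estimate N \<eta> l \<alpha> (I(Suc t := k)) (Suc t) j)
        = (\<Sum>k=1..N. ?p I k * (cum_estimate N \<eta> l \<alpha> I t j + \<alpha> j (Suc t))
             + (if k = j then ?p I j * (?b / ?p I j) else 0))"
      unfolding cum_estimate_Suc_upd by (intro sum.cong) (auto simp: algebra_simps)
    also have "\<dots> = (\<Sum>k=1..N. ?p I k) * (cum_estimate N \<eta> l \<alpha> I t j + \<alpha> j (Suc t))
        + ?p I j * (?b / ?p I j)"
      using assms by (simp add: sum.distrib sum_distrib_right)
    also have "\<dots> = cum_estimate N \<eta> l \<alpha> I t j + l j (Suc t)"
      using \<open>?p I j > 0\<close> by (simp only: sum_exp3ub_prob[OF N]) simp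
    finally show ?thesis .
  qed
  show ?case
    unfolding expectation_exp3ub_draws_Suc[OF N] step
    by (subst Bochner_Integration.integral_add)
      (auto intro!: integrable_measure_pmf_finite finite_set_exp3ub_draws[OF N] simp: Suc)
qed

section \<open>The potential and its expected growth\<close>

definition potential ::
  "nat \<Rightarrow> real \<Rightarrow> (nat \<Rightarrow> nat \<Rightarrow> real) \<Rightarrow> (nat \<Rightarrow> nat \<Rightarrow> real) \<Rightarrow> nat \<Rightarrow> (nat \<Rightarrow> nat) \<Rightarrow> real"
  where
  "potential N \<eta> l \<alpha> t I =
     \<eta> * (\<Sum>s=1..t. l (I s) s) + ln (\<Sum>i=1..N. exp (- \<eta> * cum_estimate N \<eta> l \<alpha> I t i))"

text \<open>The round's distribution is the normalised weights, so the ratio of successive weight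
  sums is the mean of \<open>exp (- \<eta> * ?x i)\<close> under it, whose logarithm
  \<open>ln_weighted_exp_le\<close> bounds.\<close>

lemma potential_Suc_upd_le:
  fixes l \<alpha> :: "nat \<Rightarrow> nat \<Rightarrow> real" and N :: nat and \<eta> :: real
  defines "p \<equiv> \<lambda>I t. exp3ub_prob N \<eta> l \<alpha> I (Suc t)"
    and "b \<equiv> \<lambda>t k. l k (Suc t) - \<alpha> k (Suc t)"
    and "d \<equiv> \<lambda>t. spread N (\<lambda>i. \<alpha> i (Suc t))"
  assumes k: "k \<in> {1..N}" and "\<eta> > 0" and b: "0 \<le> b t k"
  shows "potential N \<eta> l \<alpha> (Suc t) (I(Suc t := k))
         \<le> potential N \<eta> l \<alpha> t I + \<eta> * \<alpha> k (Suc t) - \<eta> * (\<Sum>i=1..N. p I t i * \<alpha> i (Suc t))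
           + \<eta>\<^sup>2 * (d t)\<^sup>2 / 8 + \<eta>\<^sup>2 * (b t k)\<^sup>2 / (2 * p I t k) + \<eta>\<^sup>2 * d t * b t k"
proof -
  have N: "N \<ge> 1"
    using k by auto
  let ?L = "cum_estimate N \<eta> l \<alpha> I t"
  let ?x = "\<lambda>i. b t k / p I t k * of_bool (k = i) + \<alpha> i (Suc t)"
  let ?W = "\<Sum>i=1..N. exp (- \<eta> * ?L i)"
  let ?a = "Min ((\<lambda>i. \<alpha> i (Suc t)) ` {1..N})"
  have p: "pmf (draw_expert N (exp3ub_prob N \<eta> l \<alpha> I (Suc t))) i = p I t i" if "i \<in> {1..N}" for i
    using that by (simp add: p_def pmf_draw_expert[OF N])
  have W: "?W > 0"
    using N by (intro sum_pos) auto
  have bounds: "?a \<le> \<alpha> i (Suc t) \<and> \<alpha> i (Suc t) \<le> ?a + d t" if "i \<in> {1..N}" for i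
    using that by (auto simp: d_def spread_def)
  have "0 \<le> d t"
    using bounds[OF k] by linarith
  have "ln (\<Sum>i=1..N. p I t i * exp (- \<eta> * ?x i))
      \<le> - \<eta> * (\<Sum>i=1..N. p I t i * \<alpha> i (Suc t)) + \<eta>\<^sup>2 * (d t)\<^sup>2 / 8
        - \<eta> * b t k + \<eta>\<^sup>2 * (b t k)\<^sup>2 / (2 * p I t k) + \<eta>\<^sup>2 * d t * b t k"
    using ln_weighted_exp_le[of "{1..N}" "draw_expert N (exp3ub_prob N \<eta> l \<alpha> I (Suc t))" k \<eta>
        "b t k" "d t" ?a "\<lambda>i. \<alpha> i (Suc t)"] set_draw_expert[OF N] k \<open>\<eta> > 0\<close> b \<open>0 \<le> d t\<close> bounds
    by (simp only: p[OF k] p finite_atLeastAtMost cong: sum.cong)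
  moreover have "(\<Sum>i=1..N. exp (- \<eta> * cum_estimate N \<eta> l \<alpha> (I(Suc t := k)) (Suc t) i))
      = ?W * (\<Sum>i=1..N. p I t i * exp (- \<eta> * ?x i))"
    unfolding sum_distrib_left
  proof (rule sum.cong)
    fix i
    have "?W * p I t i = exp (- \<eta> * ?L i)"
      using W by (simp add: p_def exp3ub_prob_def exp_weights_def)
    thus "exp (- \<eta> * cum_estimate N \<eta> l \<alpha> (I(Suc t := k)) (Suc t) i)
        = ?W * (p I t i * exp (- \<eta> * ?x i))"
      unfolding cum_estimate_Suc_upd b_def p_def mult.assoc[symmetric]
      by (simp only: distrib_left exp_add)
  qed simp
  moreover have "ln (?W * (\<Sum>i=1..N. p I t i * exp (- \<eta> * ?x i)))
      = ln ?W + ln (\<Sum>i=1..N. p I t i * exp (- \<eta> * ?x i))"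
    using W N exp_weights_pos[OF N]
    by (intro ln_mult_pos sum_pos) (auto simp: p_def exp3ub_prob_def)
  moreover have "(\<Sum>s=1..Suc t. l ((I(Suc t := k)) s) s) = (\<Sum>s=1..t. l (I s) s) + l k (Suc t)"
    by (auto intro!: sum.cong)
  \<comment> \<open>The loss term \<open>\<eta> * l k (Suc t)\<close> absorbs
    \<open>- \<eta> * b t k\<close> and leaves \<open>\<eta> * \<alpha> k (Suc t)\<close>.\<close>
  ultimately show ?thesis
    unfolding potential_def by (simp add: b_def algebra_simps)
qed

text \<open>Averaging the one-round bound over \<open>k\<close> cancels the two linear offset terms
  against each other, and the weight \<open>p\<close> of each draw cancels the \<open>1 / p\<close>
  in its quadratic term. The start value \<open>ln N\<close> is the logarithm of \<open>N\<close>
  unit weights.\<close>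

lemma expectation_potential_le:
  fixes l \<alpha> :: "nat \<Rightarrow> nat \<Rightarrow> real"
  assumes N: "N \<ge> 1" and "\<eta> > 0"
    and nonneg: "\<And>k s. k \<in> {1..N} \<Longrightarrow> s \<in> {1..t} \<Longrightarrow> \<alpha> k s \<le> l k s"
  shows "measure_pmf.expectation (exp3ub_draws N \<eta> l \<alpha> t) (potential N \<eta> l \<alpha> t)
         \<le> ln (real N) + (\<Sum>s=1..t. \<eta>\<^sup>2 * ((spread N (\<lambda>i. \<alpha> i s))\<^sup>2 / 8
              + (\<Sum>i=1..N. (l i s - \<alpha> i s)\<^sup>2) / 2
              + Max ((\<lambda>i. l i s - \<alpha> i s) ` {1..N}) * spread N (\<lambda>i. \<alpha> i s)))"
  using nonneg
proof (induction t)
  case 0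
  show ?case by (simp add: potential_def)
next
  case (Suc t)
  let ?p = "\<lambda>I. exp3ub_prob N \<eta> l \<alpha> I (Suc t)"
  let ?D = "exp3ub_draws N \<eta> l \<alpha> t"
  let ?\<alpha> = "\<lambda>k. \<alpha> k (Suc t)"
  let ?b = "\<lambda>k. l k (Suc t) - \<alpha> k (Suc t)"
  let ?m = "Max (?b ` {1..N})"
  let ?c = "\<lambda>s. \<eta>\<^sup>2 * ((spread N (\<lambda>i. \<alpha> i s))\<^sup>2 / 8
              + (\<Sum>i=1..N. (l i s - \<alpha> i s)\<^sup>2) / 2
              + Max ((\<lambda>i. l i s - \<alpha> i s) ` {1..N}) * spread N (\<lambda>i. \<alpha> i s))"
  let ?d = "spread N ?\<alpha>"
  have "0 \<le> ?d"
    using N Min_le_iff[of "?\<alpha> ` {1..N}"] by (auto simp: spread_def intro!: Min.coboundedI)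
  have step: "(\<Sum>k=1..N. ?p I k * potential N \<eta> l \<alpha> (Suc t) (I(Suc t := k)))
      \<le> potential N \<eta> l \<alpha> t I + ?c (Suc t)" for I
  proof -
    let ?E = "\<Sum>i=1..N. ?p I i * ?\<alpha> i"
    \<comment> \<open>\<open>?C\<close> collects what does not depend on the drawn expert
      \<open>k\<close>; for this the shifted loss in the mixed term is replaced by its maximum
      \<open>?m\<close>.\<close>
    let ?C = "potential N \<eta> l \<alpha> t I - \<eta> * ?E + \<eta>\<^sup>2 * ?d\<^sup>2 / 8 + \<eta>\<^sup>2 * ?d * ?m"
    have p_pos: "?p I k > 0" for k
      using exp_weights_pos[OF N] by (simp add: exp3ub_prob_def)
    have "?p I k * potential N \<eta> l \<alpha> (Suc t) (I(Suc t := k))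
        \<le> ?p I k * ?C + \<eta> * (?p I k * ?\<alpha> k) + \<eta>\<^sup>2 / 2 * (?b k)\<^sup>2" if k: "k \<in> {1..N}" for k
    proof -
      have "0 \<le> ?b k"
        using Suc.prems[OF k, of "Suc t"] by simp
      have "?b k \<le> ?m"
        using k by (intro Max_ge) auto
      hence "\<eta>\<^sup>2 * ?d * ?b k \<le> \<eta>\<^sup>2 * ?d * ?m"
        using \<open>0 \<le> ?d\<close> by (intro mult_left_mono) auto
      with potential_Suc_upd_le[of k N \<eta> l t \<alpha> I, OF k \<open>\<eta> > 0\<close> \<open>0 \<le> ?b k\<close>]
      have "potential N \<eta> l \<alpha> (Suc t) (I(Suc t := k))
          \<le> ?C + \<eta> * ?\<alpha> k + \<eta>\<^sup>2 * (?b k)\<^sup>2 / (2 * ?p I k)"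
        by linarith
      hence "?p I k * potential N \<eta> l \<alpha> (Suc t) (I(Suc t := k))
          \<le> ?p I k * (?C + \<eta> * ?\<alpha> k + \<eta>\<^sup>2 * (?b k)\<^sup>2 / (2 * ?p I k))"
        using p_pos[of k] by (intro mult_left_mono) auto
      also have "\<dots> = ?p I k * ?C + \<eta> * (?p I k * ?\<alpha> k) + \<eta>\<^sup>2 / 2 * (?b k)\<^sup>2"
        using p_pos[of k] by (simp only: distrib_left) simp
      finally show ?thesis .
    qed
    hence "(\<Sum>k=1..N. ?p I k * potential N \<eta> l \<alpha> (Suc t) (I(Suc t := k)))
        \<le> (\<Sum>k=1..N. ?p I k * ?C + \<eta> * (?p I k * ?\<alpha> k) + \<eta>\<^sup>2 / 2 * (?b k)\<^sup>2)"
      by (intro sum_mono) auto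
    also have "\<dots> = (\<Sum>k=1..N. ?p I k) * ?C + \<eta> * ?E + \<eta>\<^sup>2 / 2 * (\<Sum>k=1..N. (?b k)\<^sup>2)"
      by (simp only: sum.distrib sum_distrib_left sum_distrib_right)
    also have "\<dots> = potential N \<eta> l \<alpha> t I + ?c (Suc t)"
      by (simp only: sum_exp3ub_prob[OF N]) (simp add: algebra_simps)
    finally show ?thesis .
  qed
  note integrable = integrable_measure_pmf_finite[OF finite_set_exp3ub_draws[OF N]]
  have "measure_pmf.expectation (exp3ub_draws N \<eta> l \<alpha> (Suc t)) (potential N \<eta> l \<alpha> (Suc t))
      \<le> measure_pmf.expectation ?D (\<lambda>I. potential N \<eta> l \<alpha> t I + ?c (Suc t))"
    unfolding expectation_exp3ub_draws_Suc[OF N] by (intro integral_mono integrable step)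
  also have "\<dots> = measure_pmf.expectation ?D (potential N \<eta> l \<alpha> t) + ?c (Suc t)"
    by (subst Bochner_Integration.integral_add) (auto intro: integrable)
  also have "measure_pmf.expectation ?D (potential N \<eta> l \<alpha> t) \<le> ln (real N) + (\<Sum>s=1..t. ?c s)"
    using Suc.prems by (intro Suc.IH) auto
  finally show ?case
    by simp
qed

section \<open>The regret bound\<close>

theorem corollary10:
  fixes N T :: nat
    and l ub :: "nat \<Rightarrow> nat \<Rightarrow> real"
    and M :: "nat \<Rightarrow> real"
    and Q \<eta> :: real
  assumes "N \<ge> 2" and "T \<ge> 1"
    and "\<And>i t. i \<in> {1..N} \<Longrightarrow> t \<in> {1..T} \<Longrightarrow> l i t \<le> ub i t"
    and "\<And>t. t \<in> {1..T} \<Longrightarrow> Max ((\<lambda>i. ub i t - l i t) ` {1..N}) \<le> M t"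
    and "Q > 0"
    and "1 / 2 * quad_spread N T (offset ub M)
         + 2 * (\<Sum>t=1..T. \<Sum>i=1..N. (l i t - offset ub M i t)\<^sup>2)
         + 4 * (\<Sum>t=1..T. Max ((\<lambda>i. l i t - offset ub M i t) ` {1..N})
                          * spread N (\<lambda>i. offset ub M i t)) \<le> Q"
    and "\<eta> = sqrt (4 * ln (real N) / Q)"
  shows "measure_pmf.expectation (exp3ub_draws N \<eta> l (offset ub M) T) (regret N T l)
         \<le> sqrt (Q * ln (real N))"
proof -
  define \<alpha> where "\<alpha> = offset ub M"
  define D where "D = exp3ub_draws N \<eta> l \<alpha> T"
  let ?W = "\<lambda>I. \<Sum>i=1..N. exp (- \<eta> * cum_estimate N \<eta> l \<alpha> I T i)"
  have N: "N \<ge> 1" and ln_pos: "ln (real N) > 0"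
    using assms(1) by auto
  have "\<eta> > 0"
    using ln_pos assms(5,7) by simp
  have \<eta>2: "\<eta>\<^sup>2 * Q = 4 * ln (real N)"
    using ln_pos assms(5,7) by simp
  \<comment> \<open>The choice of \<open>\<eta>\<close> balances the final bound:
    \<open>\<eta>\<^sup>2 / 4 * Q\<close> equals the initial potential \<open>ln N\<close>, and
    their sum is \<open>\<eta>\<close> times the claimed bound.\<close>
  have "(\<eta> * sqrt (Q * ln (real N)))\<^sup>2 = (2 * ln (real N))\<^sup>2"
    using ln_pos assms(5) \<eta>2 by (simp add: power_mult_distrib) (simp add: power2_eq_square)
  hence \<eta>_sqrt: "\<eta> * sqrt (Q * ln (real N)) = 2 * ln (real N)"
    using ln_pos \<open>\<eta> > 0\<close> assms(5) by (subst (asm) power2_eq_iff_nonneg) auto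
  have nonneg: "\<alpha> k s \<le> l k s" if "k \<in> {1..N}" "s \<in> {1..T}" for k s
  proof -
    have "ub k s - l k s \<le> Max ((\<lambda>i. ub i s - l i s) ` {1..N})"
      using that by (intro Max_ge) auto
    with assms(4)[OF that(2)] show ?thesis
      by (simp add: \<alpha>_def offset_def)
  qed
  \<comment> \<open>The best expert in hindsight depends on the fixed losses only, not on the draws,
    so its estimate is unbiased.\<close>
  obtain j where j: "j \<in> {1..N}"
    and Min_eq: "Min ((\<lambda>j. \<Sum>t=1..T. l j t) ` {1..N}) = (\<Sum>t=1..T. l j t)"
    using Min_in[of "(\<lambda>j. \<Sum>t=1..T. l j t) ` {1..N}"] N by fastforce
  note integrable = integrable_measure_pmf_finite[OF finite_set_exp3ub_draws[OF N]]
  have "\<eta> * regret N T l I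
      \<le> potential N \<eta> l \<alpha> T I + \<eta> * (cum_estimate N \<eta> l \<alpha> I T j - (\<Sum>t=1..T. l j t))" for I
  proof -
    \<comment> \<open>Keeping only the term of \<open>j\<close> in the weight sum bounds the
      logarithm in the potential below by \<open>- \<eta>\<close> times the estimate of
      \<open>j\<close>.\<close>
    have "exp (- \<eta> * cum_estimate N \<eta> l \<alpha> I T j) \<le> ?W I"
      using j by (intro member_le_sum) auto
    hence "ln (exp (- \<eta> * cum_estimate N \<eta> l \<alpha> I T j)) \<le> ln (?W I)"
      using N by (subst ln_le_cancel_iff) (auto intro!: sum_pos)
    thus ?thesis
      unfolding regret_def Min_eq potential_def by (simp add: algebra_simps)
  qed
  hence "measure_pmf.expectation D (\<lambda>I. \<eta> * regret N T l I)
      \<le> measure_pmf.expectation D (\<lambda>I. potential N \<eta> l \<alpha> T I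
           + \<eta> * (cum_estimate N \<eta> l \<alpha> I T j - (\<Sum>t=1..T. l j t)))"
    unfolding D_def by (intro integral_mono integrable)
  also have "\<dots> = measure_pmf.expectation D (potential N \<eta> l \<alpha> T)
      + \<eta> * (measure_pmf.expectation D (\<lambda>I. cum_estimate N \<eta> l \<alpha> I T j) - (\<Sum>t=1..T. l j t))"
    unfolding D_def by (simp add: integrable)
  also have "\<dots> = measure_pmf.expectation D (potential N \<eta> l \<alpha> T)"
    unfolding D_def by (simp only: expectation_cum_estimate[OF j]) simp
  also have "\<dots> \<le> ln (real N) + (\<Sum>s=1..T. \<eta>\<^sup>2 * ((spread N (\<lambda>i. \<alpha> i s))\<^sup>2 / 8
              + (\<Sum>i=1..N. (l i s - \<alpha> i s)\<^sup>2) / 2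
              + Max ((\<lambda>i. l i s - \<alpha> i s) ` {1..N}) * spread N (\<lambda>i. \<alpha> i s)))"
    unfolding D_def by (rule expectation_potential_le[OF N \<open>\<eta> > 0\<close> nonneg])
  \<comment> \<open>Extracting \<open>\<eta>\<^sup>2 / 4\<close> turns the coefficients 1/8, 1/2 and
    1 into 1/2, 2 and 4.\<close>
  also have "\<dots> = ln (real N) + \<eta>\<^sup>2 / 4 * (1 / 2 * quad_spread N T \<alpha>
         + 2 * (\<Sum>t=1..T. \<Sum>i=1..N. (l i t - \<alpha> i t)\<^sup>2)
         + 4 * (\<Sum>t=1..T. Max ((\<lambda>i. l i t - \<alpha> i t) ` {1..N}) * spread N (\<lambda>i. \<alpha> i t)))"
    unfolding quad_spread_def sum_distrib_left[symmetric] sum.distrib sum_divide_distrib[symmetric]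
    by (simp add: algebra_simps)
  also have "\<dots> \<le> ln (real N) + \<eta>\<^sup>2 / 4 * Q"
    using assms(6) by (intro add_left_mono mult_left_mono) (auto simp: \<alpha>_def)
  also have "\<dots> = \<eta> * sqrt (Q * ln (real N))"
    using \<eta>2 \<eta>_sqrt by simp
  finally show ?thesis
    using \<open>\<eta> > 0\<close> by (simp add: D_def \<alpha>_def)
qed

end
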